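(* Let $G$ be a $(z,w)$-colored graph and let $G'$ be a rooted $(z,w)$-colored graph whose root is colored $z$. Let $G\triangleright_z G'$ be the $z$-comb product of $G$ and $G'$. Then $$f_{G\triangleright_z G'}(z,w) = f_G\bigl(-g_{G'}(z,w),\, w\bigr).$$
   Context: Let $\Pi=\{z\in\mathbb{C}:\operatorname{Im} z>0\}$; $(z,w)\in\Pi^2$. Graphs are finite, simple and undirected. A $(z,w)$-colored graph is such a graph $G$ with each vertex labelled (colored) by one of the two variables $z$ or $w$. Its colored adjacency matrix is $\mathcal{A}_G = A_G - D$, where $A_G$ is the usual $0/1$ adjacency matrix and $D$ is the diagonal matrix whose $k$-th diagonal entry is the color ($z$ or $w$) of vertex $k$. The representing function of $G$ with respect to vertex $k$ is $f_G^k(z,w) = (\mathcal{A}_G^{-1})_{(k,k)}$, the $(k,k)$ entry of the inverse matrix. We write $f_G=f_G^1$, where vertex $1$ is a fixed base vertex, and $g_G = 1/f_G$. For the rooted graph $G'$, the base vertex is the root, so $g_{G'} = 1/f_{G'}$ with $f_{G'}$ computed at the root. The $z$-comb product $G\triangleright_z G'$ is the colored graph obtained from $G$ by attaching, at each $z$-colored vertex $v$ of $G$, a separate copy of $G'$ by identifying the root of that copy with $v$ (the identified vertex keeps the single color $z$); all other vertices keep their colors. The base vertex (vertex $1$) of $G\triangleright_z G'$ is the base vertex of $G$. *)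

theory Defs
  imports
    Complex_Main
    "HOL-Library.Countable_Set"
    "Graph_Theory.Pair_Digraph"
    "Jordan_Normal_Form.Gauss_Jordan_Elimination"
begin

datatype color = ColZ | ColW

text \<open>For a rooted graph, the base vertex is the root.\<close>

record 'v colored_graph =
  ugraph :: "'v pair_pre_digraph"
  color_of :: "'v \<Rightarrow> color"
  base :: 'v

text \<open>The locale \<open>pair_graph\<close> says: finite, arcs within the vertex set, symmetric, loop-free.
  An undirected edge is a pair of opposite arcs.\<close>

definition is_colored_graph :: "'v colored_graph \<Rightarrow> bool" where
  "is_colored_graph G \<longleftrightarrow> pair_graph (ugraph G) \<and> base G \<in> pverts (ugraph G)"

fun color_val :: "complex \<Rightarrow> complex \<Rightarrow> color \<Rightarrow> complex" where
  "color_val z w ColZ = z"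
| "color_val z w ColW = w"

text \<open>Library matrices are indexed by \<open>{0..<n}\<close>. The vertices are numbered by
  \<open>to_nat_on V\<close>, with inverse \<open>from_nat_into V\<close>, which for finite \<open>V\<close> is a bijection
  onto \<open>{..<card V}\<close>.\<close>

abbreviation vertex_index :: "'v colored_graph \<Rightarrow> 'v \<Rightarrow> nat" where
  "vertex_index G \<equiv> to_nat_on (pverts (ugraph G))"

abbreviation nth_vertex :: "'v colored_graph \<Rightarrow> nat \<Rightarrow> 'v" where
  "nth_vertex G \<equiv> from_nat_into (pverts (ugraph G))"

abbreviation num_verts :: "'v colored_graph \<Rightarrow> nat" where
  "num_verts G \<equiv> card (pverts (ugraph G))"

definition adjacency_mat :: "'v colored_graph \<Rightarrow> complex mat" where
  "adjacency_mat G = mat (num_verts G) (num_verts G)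
     (\<lambda>(i, j). if (nth_vertex G i, nth_vertex G j) \<in> parcs (ugraph G) then 1 else 0)"

definition color_mat :: "'v colored_graph \<Rightarrow> complex \<Rightarrow> complex \<Rightarrow> complex mat" where
  "color_mat G z w = mat (num_verts G) (num_verts G)
     (\<lambda>(i, j). if i = j then color_val z w (color_of G (nth_vertex G i)) else 0)"

definition colored_adjacency_mat :: "'v colored_graph \<Rightarrow> complex \<Rightarrow> complex \<Rightarrow> complex mat" where
  "colored_adjacency_mat G z w = adjacency_mat G - color_mat G z w"

text \<open>For \<open>z\<close>, \<open>w\<close> in the open upper half-plane the colored adjacency matrix is invertible (its
  imaginary part is negative definite), so \<open>mat_inverse\<close> does not return \<open>None\<close> there.\<close>

definition rep_fun_at :: "'v colored_graph \<Rightarrow> 'v \<Rightarrow> complex \<Rightarrow> complex \<Rightarrow> complex" where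
  "rep_fun_at G k z w =
     the (mat_inverse (colored_adjacency_mat G z w)) $$ (vertex_index G k, vertex_index G k)"

definition rep_fun :: "'v colored_graph \<Rightarrow> complex \<Rightarrow> complex \<Rightarrow> complex" where
  "rep_fun G = rep_fun_at G (base G)"

definition recip_rep_fun :: "'v colored_graph \<Rightarrow> complex \<Rightarrow> complex \<Rightarrow> complex" where
  "recip_rep_fun G z w = 1 / rep_fun G z w"

text \<open>In the comb product, \<open>(v, base G')\<close> is the vertex \<open>v\<close> of \<open>G\<close>, identified with the root of
  the copy of \<open>G'\<close> at \<open>v\<close> when \<open>v\<close> has color \<open>z\<close>; for such \<open>v\<close> and \<open>u \<noteq> base G'\<close>, \<open>(v, u)\<close> is
  the vertex \<open>u\<close> of that copy.\<close>

definition z_comb :: "'a colored_graph \<Rightarrow> 'b colored_graph \<Rightarrow> ('a \<times> 'b) colored_graph" where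
  "z_comb G G' = \<lparr>
     ugraph = \<lparr>
       pverts = {(v, base G') | v. v \<in> pverts (ugraph G)}
         \<union> {(v, u) | v u. v \<in> pverts (ugraph G) \<and> color_of G v = ColZ \<and> u \<in> pverts (ugraph G')},
       parcs = {((v, base G'), (v', base G')) | v v'. (v, v') \<in> parcs (ugraph G)}
         \<union> {((v, u), (v, u')) | v u u'. v \<in> pverts (ugraph G) \<and> color_of G v = ColZ
              \<and> (u, u') \<in> parcs (ugraph G')} \<rparr>,
     color_of = (\<lambda>(v, u). if u = base G' then color_of G v else color_of G' u),
     base = (base G, base G') \<rparr>"

end

theory Submission
  imports Defs "Jordan_Normal_Form.Determinant"
begin

text \<open>The entry \<open>f\<^sub>G\<^sup>k\<close> is the value at \<open>k\<close> of the unique vertex function \<open>x\<close> with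
  \<open>\<A>\<^sub>G x = e\<^sub>k\<close>; uniqueness holds because the imaginary part of the quadratic form of
  \<open>\<A>\<^sub>G\<close> is negative definite. If \<open>y\<close> solves this system for the root of \<open>G'\<close>, then
  \<open>Im (- 1 / y root) > 0\<close>, so the system of \<open>G\<close> at \<open>(- 1 / y root, w)\<close> has a solution \<open>x\<close>, and
  \<open>(v, u) \<mapsto> x v * y u / y root\<close> solves the system of the comb product.\<close>

section \<open>Colored adjacency operator and its quadratic form\<close>

text \<open>The action of the colored adjacency matrix on vertex functions, with no vertex numbering
  involved. This form suits the comb product, where a numbering of the pairs would be unwieldy. The
  image of \<open>{v}\<close> under the arcs is the neighborhood of \<open>v\<close>.\<close>

definition adj_op :: "'v colored_graph \<Rightarrow> complex \<Rightarrow> complex \<Rightarrow> ('v \<Rightarrow> complex) \<Rightarrow> 'v \<Rightarrow> complex" where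
  "adj_op G z w x v = (\<Sum>u\<in>parcs (ugraph G) `` {v}. x u) - color_val z w (color_of G v) * x v"

lemma colored_graph_facts:
  assumes "is_colored_graph G"
  shows finite_verts: "finite (pverts (ugraph G))"
    and base_in_verts: "base G \<in> pverts (ugraph G)"
    and arcs_subset: "parcs (ugraph G) \<subseteq> pverts (ugraph G) \<times> pverts (ugraph G)"
    and arcs_sym: "(u, v) \<in> parcs (ugraph G) \<Longrightarrow> (v, u) \<in> parcs (ugraph G)"
    and arcs_loopfree: "(v, v) \<notin> parcs (ugraph G)"
proof -
  interpret pair_graph "ugraph G" using assms by (simp add: is_colored_graph_def)
  show "finite (pverts (ugraph G))" by simp
  show "base G \<in> pverts (ugraph G)" using assms by (simp add: is_colored_graph_def)
  show "parcs (ugraph G) \<subseteq> pverts (ugraph G) \<times> pverts (ugraph G)"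
    using in_arcsD1 in_arcsD2 by auto
  show "(u, v) \<in> parcs (ugraph G) \<Longrightarrow> (v, u) \<in> parcs (ugraph G)"
    using arcs_symmetric by blast
  show "(v, v) \<notin> parcs (ugraph G)" using no_loops by fastforce
qed

lemma is_colored_graphI:
  assumes "finite (pverts (ugraph G))" "base G \<in> pverts (ugraph G)"
    and "parcs (ugraph G) \<subseteq> pverts (ugraph G) \<times> pverts (ugraph G)"
    and "\<And>u v. (u, v) \<in> parcs (ugraph G) \<Longrightarrow> (v, u) \<in> parcs (ugraph G)"
    and "\<And>v. (v, v) \<notin> parcs (ugraph G)"
  shows "is_colored_graph G"
  unfolding is_colored_graph_def
proof (intro conjI)
  have fin: "finite (parcs (ugraph G))"
    using assms(1,3) finite_subset by blast
  show "pair_graph (ugraph G)"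
    using assms fin
    by unfold_locales (auto simp: symmetric_def sym_def arcs_ends_def arc_to_ends_def)
qed fact

text \<open>The adjacency part of the quadratic form is real since the adjacency matrix is symmetric.\<close>

lemma Im_quadratic_form:
  assumes G: "is_colored_graph G"
  defines "V \<equiv> pverts (ugraph G)"
  shows "Im (\<Sum>v\<in>V. cnj (x v) * adj_op G z w x v)
    = - (\<Sum>v\<in>V. Im (color_val z w (color_of G v)) * (cmod (x v))\<^sup>2)"
proof -
  let ?E = "parcs (ugraph G)"
  let ?S = "\<Sum>v\<in>V. cnj (x v) * (\<Sum>u\<in>?E `` {v}. x u)"
  have fV: "finite V" using finite_verts[OF G] by (simp add: V_def)
  have fE: "finite (?E `` {v})" for v
    using finite_subset[of "?E `` {v}" V] arcs_subset[OF G] fV by (auto simp: V_def)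
  \<comment> \<open>Extending the inner sum from the neighborhood of \<open>v\<close> to all of
    \<open>V\<close> makes both index ranges equal, so that the order of summation can be
    exchanged.\<close>
  have S: "?S = (\<Sum>v\<in>V. \<Sum>u\<in>V. if (v, u) \<in> ?E then cnj (x v) * x u else 0)"
  proof (intro sum.cong refl)
    fix v
    have "(\<Sum>u\<in>V. if (v, u) \<in> ?E then cnj (x v) * x u else 0)
      = (\<Sum>u\<in>{u\<in>V. (v, u) \<in> ?E}. cnj (x v) * x u)"
      using fV by (simp add: sum.inter_filter)
    also have "{u\<in>V. (v, u) \<in> ?E} = ?E `` {v}"
      using arcs_subset[OF G] by (auto simp: V_def)
    finally show "cnj (x v) * (\<Sum>u\<in>?E `` {v}. x u) =
        (\<Sum>u\<in>V. if (v, u) \<in> ?E then cnj (x v) * x u else 0)"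
      by (simp add: sum_distrib_left)
  qed
  have "cnj ?S = (\<Sum>v\<in>V. \<Sum>u\<in>V. if (v, u) \<in> ?E then cnj (x u) * x v else 0)"
    unfolding S by (simp add: if_distrib[of cnj] mult.commute cong: if_cong)
  also have "\<dots> = (\<Sum>u\<in>V. \<Sum>v\<in>V. if (v, u) \<in> ?E then cnj (x u) * x v else 0)"
    by (rule sum.swap)
  also have "\<dots> = ?S"
    unfolding S using arcs_sym[OF G] by (intro sum.cong refl if_cong) blast
  finally have Im_S: "Im ?S = 0"
    by (simp only: Reals_cnj_iff[symmetric] complex_is_Real_iff)
  have Im_diag: "Im (cnj a * (c * a)) = Im c * (cmod a)\<^sup>2" for a c :: complex
    unfolding cmod_power2 by (simp add: algebra_simps power2_eq_square)
  have "(\<Sum>v\<in>V. cnj (x v) * adj_op G z w x v)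
    = ?S - (\<Sum>v\<in>V. cnj (x v) * (color_val z w (color_of G v) * x v))"
    by (simp only: adj_op_def right_diff_distrib sum_subtractf)
  moreover have "Im (\<Sum>v\<in>V. cnj (x v) * (color_val z w (color_of G v) * x v))
    = (\<Sum>v\<in>V. Im (color_val z w (color_of G v)) * (cmod (x v))\<^sup>2)"
    by (simp only: Im_sum Im_diag)
  ultimately show ?thesis
    by (simp only: minus_complex.sel Im_S diff_0)
qed

text \<open>On the kernel the quadratic form vanishes, so a sum of nonnegative terms is zero. Each
  weight is the imaginary part of \<open>z\<close> or \<open>w\<close>, hence strictly positive,
  which forces every \<open>x v\<close> to vanish.\<close>

lemma adj_op_injective:
  assumes G: "is_colored_graph G" and "Im z > 0" "Im w > 0"
    and zero: "\<And>v. v \<in> pverts (ugraph G) \<Longrightarrow> adj_op G z w x v = 0"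
    and v: "v \<in> pverts (ugraph G)"
  shows "x v = 0"
proof -
  have pos: "Im (color_val z w c) > 0" for c using assms(2,3) by (cases c) auto
  have "(\<Sum>v\<in>pverts (ugraph G). Im (color_val z w (color_of G v)) * (cmod (x v))\<^sup>2) = 0"
    using Im_quadratic_form[OF G, of x z w] zero by simp
  then have "Im (color_val z w (color_of G v)) * (cmod (x v))\<^sup>2 = 0"
    using v finite_verts[OF G] pos
    by (subst (asm) sum_nonneg_eq_0_iff) (auto simp: less_imp_le)
  then show ?thesis using pos[of "color_of G v"] by simp
qed

section \<open>Passage between matrices and vertex functions\<close>

lemma vertex_numbering:
  assumes G: "is_colored_graph G"
  shows vertex_index_nth: "i < num_verts G \<Longrightarrow> vertex_index G (nth_vertex G i) = i"
    and nth_vertex_index: "v \<in> pverts (ugraph G) \<Longrightarrow> nth_vertex G (vertex_index G v) = v"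
    and nth_vertex_in: "i < num_verts G \<Longrightarrow> nth_vertex G i \<in> pverts (ugraph G)"
    and vertex_index_less: "v \<in> pverts (ugraph G) \<Longrightarrow> vertex_index G v < num_verts G"
proof -
  note bij = to_nat_on_finite[OF finite_verts[OF G]]
  show "i < num_verts G \<Longrightarrow> vertex_index G (nth_vertex G i) = i"
    using bij by (intro to_nat_on_from_nat_into) (auto simp: bij_betw_def)
  show "v \<in> pverts (ugraph G) \<Longrightarrow> nth_vertex G (vertex_index G v) = v"
    using finite_verts[OF G] by (simp add: countable_finite)
  show "i < num_verts G \<Longrightarrow> nth_vertex G i \<in> pverts (ugraph G)"
    using base_in_verts[OF G] by (intro from_nat_into) auto
  show "v \<in> pverts (ugraph G) \<Longrightarrow> vertex_index G v < num_verts G"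
    using bij by (auto simp: bij_betw_def)
qed

lemma colored_adjacency_mat_mult_vec:
  assumes G: "is_colored_graph G" and i: "i < num_verts G"
  shows "(colored_adjacency_mat G z w *\<^sub>v vec (num_verts G) (\<lambda>j. x (nth_vertex G j))) $ i
    = adj_op G z w x (nth_vertex G i)"
proof -
  let ?E = "parcs (ugraph G)" and ?V = "pverts (ugraph G)" and ?n = "num_verts G"
  let ?v = "nth_vertex G i"
  let ?c = "color_val z w (color_of G ?v)"
  have fV: "finite ?V" using finite_verts[OF G] .
  have "(colored_adjacency_mat G z w *\<^sub>v vec ?n (\<lambda>j. x (nth_vertex G j))) $ i
    = (\<Sum>j<?n. (if (?v, nth_vertex G j) \<in> ?E then x (nth_vertex G j) else 0)
        - (if i = j then ?c * x (nth_vertex G j) else 0))"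
    using i unfolding colored_adjacency_mat_def adjacency_mat_def color_mat_def
    by (auto simp: scalar_prod_def lessThan_atLeast0 left_diff_distrib intro!: sum.cong)
  also have "\<dots> = (\<Sum>j<?n. if (?v, nth_vertex G j) \<in> ?E then x (nth_vertex G j) else 0) - ?c * x ?v"
    using i by (simp add: sum_subtractf)
  also have "(\<Sum>j<?n. if (?v, nth_vertex G j) \<in> ?E then x (nth_vertex G j) else 0)
    = (\<Sum>u\<in>?V. if (?v, u) \<in> ?E then x u else 0)"
    by (rule sum.reindex_bij_betw[OF bij_betw_from_nat_into_finite[OF fV]])
  also have "\<dots> = (\<Sum>u\<in>{u\<in>?V. (?v, u) \<in> ?E}. x u)"
    using fV by (simp add: sum.inter_filter)
  also have "{u\<in>?V. (?v, u) \<in> ?E} = ?E `` {?v}" using arcs_subset[OF G] by auto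
  finally show ?thesis by (simp add: adj_op_def)
qed

lemma colored_adjacency_mat_carrier [simp]:
  "colored_adjacency_mat G z w \<in> carrier_mat (num_verts G) (num_verts G)"
  by (simp add: colored_adjacency_mat_def color_mat_def adjacency_mat_def minus_mat_def)

text \<open>A kernel vector, read as a vertex function through the numbering, is annihilated by
  \<open>adj_op\<close> and so vanishes by \<open>adj_op_injective\<close>. Hence the determinant is
  nonzero and \<open>mat_inverse\<close> returns a genuine two-sided inverse.\<close>

lemma colored_adjacency_mat_inverse:
  assumes G: "is_colored_graph G" and im: "Im z > 0" "Im w > 0"
  defines "n \<equiv> num_verts G" and "A \<equiv> colored_adjacency_mat G z w"
  obtains B where "mat_inverse A = Some B" "B \<in> carrier_mat n n" "A * B = 1\<^sub>m n" "B * A = 1\<^sub>m n"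
proof -
  have A: "A \<in> carrier_mat n n" by (simp add: A_def n_def)
  have "det A \<noteq> 0"
  proof
    assume "det A = 0"
    then obtain u where u: "u \<in> carrier_vec n" "u \<noteq> 0\<^sub>v n" "A *\<^sub>v u = 0\<^sub>v n"
      using det_0_iff_vec_prod_zero_field[OF A] by blast
    define x where "x v = u $ vertex_index G v" for v
    have nth: "vertex_index G (nth_vertex G j) = j" if "j < n" for j
      using vertex_index_nth[OF G] that by (simp add: n_def)
    have ux: "vec n (\<lambda>j. x (nth_vertex G j)) = u"
      using u(1) by (intro eq_vecI) (auto simp: x_def nth)
    have "adj_op G z w x v = 0" if v: "v \<in> pverts (ugraph G)" for v
    proof -
      have i: "vertex_index G v < n"
        using vertex_index_less[OF G v] by (simp add: n_def)
      show ?thesis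
        using colored_adjacency_mat_mult_vec[OF G, of "vertex_index G v" z w x] i u(3) ux nth_vertex_index[OF G v]
        by (simp add: n_def A_def)
    qed
    from adj_op_injective[OF G im this] have zero: "v \<in> pverts (ugraph G) \<Longrightarrow> x v = 0" for v .
    have "u = 0\<^sub>v n"
    proof (rule eq_vecI)
      fix j assume j: "j < dim_vec (0\<^sub>v n :: complex vec)"
      then have "nth_vertex G j \<in> pverts (ugraph G)"
        using nth_vertex_in[OF G] by (simp add: n_def)
      from zero[OF this] show "u $ j = 0\<^sub>v n $ j" using j nth by (simp add: x_def)
    qed (use u in auto)
    then show False using u by simp
  qed
  then have "A \<in> Units (ring_mat TYPE(complex) n ())"
    by (rule det_non_zero_imp_unit[OF A])
  then obtain B where B: "mat_inverse A = Some B"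
    using mat_inverse(1)[OF A, where b = "()"] by (cases "mat_inverse A") auto
  then show ?thesis using mat_inverse(2)[OF A B] that by blast
qed

section \<open>Representing functions from solutions of linear systems\<close>

text \<open>Applying the inverse \<open>B\<close> to \<open>A *\<^sub>v u = unit_vec n i\<close>
  shows that \<open>u\<close> is column \<open>i\<close> of \<open>B\<close>, whose entry
  \<open>i\<close> is the representing function. From here on it suffices to exhibit
  solutions.\<close>

lemma rep_fun_at_eqI:
  assumes G: "is_colored_graph G" and im: "Im z > 0" "Im w > 0"
    and k: "k \<in> pverts (ugraph G)"
    and x: "\<And>v. v \<in> pverts (ugraph G) \<Longrightarrow> adj_op G z w x v = of_bool (v = k)"
  shows "rep_fun_at G k z w = x k"
proof -
  define n where "n = num_verts G"
  define A where "A = colored_adjacency_mat G z w"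
  define i where "i = vertex_index G k"
  define u where "u = vec n (\<lambda>j. x (nth_vertex G j))"
  obtain B where B: "mat_inverse A = Some B" "B \<in> carrier_mat n n" "B * A = 1\<^sub>m n"
    using colored_adjacency_mat_inverse[OF G im] unfolding A_def n_def by metis
  have A: "A \<in> carrier_mat n n" by (simp add: A_def n_def)
  have i: "i < n"
    using vertex_index_less[OF G k] by (simp add: n_def i_def)
  have nth: "nth_vertex G i = k" using nth_vertex_index[OF G k] by (simp add: i_def)
  have "A *\<^sub>v u = unit_vec n i"
  proof (rule eq_vecI)
    fix j assume "j < dim_vec (unit_vec n i :: complex vec)"
    then have j: "j < n" by simp
    then have "nth_vertex G j \<in> pverts (ugraph G)"
      using nth_vertex_in[OF G] by (simp add: n_def)
    moreover have "nth_vertex G j = k \<longleftrightarrow> j = i"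
      using vertex_index_nth[OF G, of j] j nth by (auto simp: n_def i_def)
    ultimately have "(A *\<^sub>v u) $ j = of_bool (j = i)"
      using colored_adjacency_mat_mult_vec[OF G, of j z w x] j x
      by (simp add: A_def u_def n_def)
    then show "(A *\<^sub>v u) $ j = unit_vec n i $ j" using i j by (simp add: unit_vec_def)
  qed (use A in auto)
  moreover have "B *\<^sub>v (A *\<^sub>v u) = u"
    using assoc_mult_mat_vec[OF B(2) A, of u] B(3) by (simp add: u_def)
  ultimately have "u $ i = (B *\<^sub>v unit_vec n i) $ i" by simp
  also have "\<dots> = B $$ (i, i)" using B(2) i by simp
  finally show ?thesis
    using B(1) i nth by (simp add: rep_fun_at_def A_def u_def i_def)
qed

text \<open>The solution is the column of the inverse matrix that belongs to \<open>k\<close>, read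
  as a vertex function.\<close>

lemma adj_op_solution:
  assumes G: "is_colored_graph G" and im: "Im z > 0" "Im w > 0"
    and k: "k \<in> pverts (ugraph G)"
  obtains x where "\<And>v. v \<in> pverts (ugraph G) \<Longrightarrow> adj_op G z w x v = of_bool (v = k)"
proof -
  define n where "n = num_verts G"
  define A where "A = colored_adjacency_mat G z w"
  define i where "i = vertex_index G k"
  obtain B where B: "B \<in> carrier_mat n n" "A * B = 1\<^sub>m n"
    using colored_adjacency_mat_inverse[OF G im] unfolding A_def n_def by metis
  define u where "u = B *\<^sub>v unit_vec n i"
  define x where "x v = u $ vertex_index G v" for v
  have A: "A \<in> carrier_mat n n" by (simp add: A_def n_def)
  have Au: "A *\<^sub>v u = unit_vec n i"
    using assoc_mult_mat_vec[OF A B(1), of "unit_vec n i"] B(2) by (simp add: u_def)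
  have "vec n (\<lambda>j. x (nth_vertex G j)) = u"
    using B(1) vertex_index_nth[OF G]
    by (intro eq_vecI) (auto simp: x_def u_def n_def)
  then have *: "adj_op G z w x (nth_vertex G j) = unit_vec n i $ j" if "j < n" for j
    using colored_adjacency_mat_mult_vec[OF G, of j z w x] that Au by (simp add: A_def n_def)
  show ?thesis
  proof (rule that)
    fix v assume v: "v \<in> pverts (ugraph G)"
    have "vertex_index G v = i \<longleftrightarrow> v = k"
      unfolding i_def using nth_vertex_index[OF G v] nth_vertex_index[OF G k] by metis
    moreover have "vertex_index G v < n" "i < n"
      using vertex_index_less[OF G] v k by (simp_all add: n_def i_def)
    ultimately show "adj_op G z w x v = of_bool (v = k)"
      using *[of "vertex_index G v"] by (simp add: nth_vertex_index[OF G v] unit_vec_def)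
  qed
qed

text \<open>Pairing the solution \<open>y\<close> for the base vertex with itself gives
  \<open>cnj (y (base G))\<close>; the sign from conjugation cancels the one in
  \<open>Im_quadratic_form\<close>. This positivity makes \<open>- 1 / f\<close> an admissible value
  for the color \<open>z\<close>.\<close>

lemma Im_rep_fun_pos:
  assumes G: "is_colored_graph G" and im: "Im z > 0" "Im w > 0"
  shows "Im (rep_fun G z w) > 0"
proof -
  let ?V = "pverts (ugraph G)"
  have b: "base G \<in> ?V" and fV: "finite ?V"
    using base_in_verts[OF G] finite_verts[OF G] .
  obtain y where y: "\<And>v. v \<in> ?V \<Longrightarrow> adj_op G z w y v = of_bool (v = base G)"
    using adj_op_solution[OF G im b] by blast
  have eq: "rep_fun G z w = y (base G)"
    unfolding rep_fun_def by (rule rep_fun_at_eqI[OF G im b y])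
  have pos: "Im (color_val z w c) > 0" for c using im by (cases c) auto
  have "(\<Sum>v\<in>?V. cnj (y v) * adj_op G z w y v) = (\<Sum>v\<in>?V. if v = base G then cnj (y v) else 0)"
    by (intro sum.cong) (auto simp: y)
  then have "Im (y (base G)) = (\<Sum>v\<in>?V. Im (color_val z w (color_of G v)) * (cmod (y v))\<^sup>2)"
    using Im_quadratic_form[OF G, of y z w] b fV by simp
  also have "\<dots> > 0"
  proof -
    \<comment> \<open>A solution vanishing on all vertices would give 0 instead of 1 at the base
      vertex.\<close>
    have "\<exists>v\<in>?V. y v \<noteq> 0"
    proof (rule ccontr)
      assume "\<not> ?thesis"
      then have "\<And>u. u \<in> ?V \<Longrightarrow> y u = 0" by blast
      moreover have "parcs (ugraph G) `` {base G} \<subseteq> ?V" using arcs_subset[OF G] by auto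
      ultimately have "adj_op G z w y (base G) = 0"
        using b by (auto simp: adj_op_def intro!: sum.neutral)
      then show False using y[OF b] by simp
    qed
    then obtain v where "v \<in> ?V" "y v \<noteq> 0" by blast
    then show ?thesis
      using pos fV by (intro sum_pos2[where i = v]) (auto simp: less_imp_le)
  qed
  finally show ?thesis by (simp add: eq)
qed

section \<open>The comb product\<close>

lemma is_colored_graph_z_comb:
  assumes G: "is_colored_graph G" and G': "is_colored_graph G'"
  shows "is_colored_graph (z_comb G G')"
proof (rule is_colored_graphI)
  have "pverts (ugraph (z_comb G G')) \<subseteq> pverts (ugraph G) \<times> pverts (ugraph G')"
    using base_in_verts[OF G'] by (auto simp: z_comb_def)
  then show "finite (pverts (ugraph (z_comb G G')))"
    by (rule finite_subset) (simp add: finite_verts[OF G] finite_verts[OF G'])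
  show "base (z_comb G G') \<in> pverts (ugraph (z_comb G G'))"
    using base_in_verts[OF G] by (simp add: z_comb_def)
  show "parcs (ugraph (z_comb G G'))
      \<subseteq> pverts (ugraph (z_comb G G')) \<times> pverts (ugraph (z_comb G G'))"
    using arcs_subset[OF G] arcs_subset[OF G'] by (auto simp: z_comb_def)
  show "(q, p) \<in> parcs (ugraph (z_comb G G'))" if "(p, q) \<in> parcs (ugraph (z_comb G G'))" for p q
    using that arcs_sym[OF G] arcs_sym[OF G'] by (auto simp: z_comb_def)
  show "(p, p) \<notin> parcs (ugraph (z_comb G G'))" for p
    using arcs_loopfree[OF G] arcs_loopfree[OF G'] by (auto simp: z_comb_def)
qed

theorem corollary3p6:
  fixes G :: "'a colored_graph" and G' :: "'b colored_graph" and z w :: complex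
  assumes "is_colored_graph G"
    and "is_colored_graph G'"
    and "color_of G' (base G') = ColZ"
    and "Im z > 0" and "Im w > 0"
  shows "rep_fun (z_comb G G') z w = rep_fun G (- recip_rep_fun G' z w) w"
proof -
  note G = assms(1) and G' = assms(2) and im = assms(4,5)
  let ?V = "pverts (ugraph G)" and ?E = "parcs (ugraph G)" and ?E' = "parcs (ugraph G')"
  let ?H = "z_comb G G'" and ?r = "base G'"
  define f where "f = rep_fun G' z w"
  have f_pos: "Im f > 0" unfolding f_def by (rule Im_rep_fun_pos[OF G' im])
  then have f0: "f \<noteq> 0" by auto
  \<comment> \<open>The imaginary part of \<open>- (1 / f)\<close> is that of \<open>f\<close>
    divided by the squared modulus of \<open>f\<close>.\<close>
  have im': "Im (- (1 / f)) > 0"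
    using f_pos by (auto simp: Im_divide complex_eq_iff sum_power2_gt_zero_iff)
  have r: "?r \<in> pverts (ugraph G')" and b: "base G \<in> ?V"
    using base_in_verts G G' by auto
  obtain y where y: "\<And>u. u \<in> pverts (ugraph G') \<Longrightarrow> adj_op G' z w y u = of_bool (u = ?r)"
    using adj_op_solution[OF G' im r] by blast
  have yr: "y ?r = f"
    unfolding f_def rep_fun_def by (rule rep_fun_at_eqI[OF G' im r y, symmetric])
  obtain x where x: "\<And>v. v \<in> ?V \<Longrightarrow> adj_op G (- (1 / f)) w x v = of_bool (v = base G)"
    using adj_op_solution[OF G im' im(2) b] by blast
  have xb: "rep_fun G (- (1 / f)) w = x (base G)"
    unfolding rep_fun_def by (rule rep_fun_at_eqI[OF G im' im(2) b x])
  \<comment> \<open>On the copy at \<open>v\<close>, \<open>y\<close> is rescaled so that its root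
    value \<open>f\<close> becomes \<open>x v\<close>. At a \<open>w\<close>-colored
    \<open>v\<close> only the root occurs, and there \<open>X\<close> equals
    \<open>x v\<close>.\<close>
  define X where "X = (\<lambda>(v, u). x v * y u / f)"
  have Xr: "X (v, ?r) = x v" for v using f0 by (simp add: X_def yr)
  have finE: "finite (?E `` {v})" "finite (?E' `` {u})" for v u
    using arcs_subset[OF G] arcs_subset[OF G'] finite_verts[OF G] finite_verts[OF G']
    by (auto intro: finite_subset[of "?E `` {v}" ?V] finite_subset[of _ "pverts (ugraph G')"])
  \<comment> \<open>The contribution of the neighbors inside one copy, found by solving the equation
    of \<open>y\<close> at \<open>u\<close> for its neighbor sum.\<close>
  have copy: "(\<Sum>q\<in>Pair v ` (?E' `` {u}). X q)
      = x v / f * (of_bool (u = ?r) + color_val z w (color_of G' u) * y u)"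
    if "u \<in> pverts (ugraph G')" for v u
  proof -
    have "(\<Sum>q\<in>Pair v ` (?E' `` {u}). X q) = (\<Sum>u'\<in>?E' `` {u}. x v / f * y u')"
      by (subst sum.reindex) (auto simp: inj_on_def X_def)
    also have "\<dots> = x v / f * (\<Sum>u'\<in>?E' `` {u}. y u')" by (simp add: sum_distrib_left)
    also have "(\<Sum>u'\<in>?E' `` {u}. y u') = of_bool (u = ?r) + color_val z w (color_of G' u) * y u"
      using y[OF that] unfolding adj_op_def diff_eq_eq .
    finally show ?thesis .
  qed
  have "adj_op ?H z w X p = of_bool (p = base ?H)" if p: "p \<in> pverts (ugraph ?H)" for p
  proof -
    obtain v u where vu: "p = (v, u)" by (cases p)
    then have v: "v \<in> ?V" and u: "u = ?r \<or> color_of G v = ColZ \<and> u \<in> pverts (ugraph G')"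
      using p by (auto simp: z_comb_def)
    show ?thesis
    proof (cases "u = ?r")
      case False
      \<comment> \<open>Away from the root all neighbors lie in the same copy, where
        \<open>X\<close> is a multiple of \<open>y\<close>, and the equation of \<open>y\<close> has
        right-hand side 0.\<close>
      then have nbrs: "parcs (ugraph ?H) `` {p} = Pair v ` (?E' `` {u})"
        using u v vu by (auto simp: z_comb_def)
      have "adj_op ?H z w X p = 0"
        unfolding adj_op_def nbrs using copy[of u v] u False vu by (auto simp: z_comb_def X_def)
      then show ?thesis using False vu by (simp add: z_comb_def)
    next
      case True
      let ?N = "(\<lambda>v'. (v', ?r)) ` (?E `` {v})"
      have N: "(\<Sum>q\<in>?N. X q) = (\<Sum>v'\<in>?E `` {v}. x v')"
        by (subst sum.reindex) (auto simp: inj_on_def Xr)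
      have "adj_op ?H z w X p = adj_op G (- (1 / f)) w x v"
      proof (cases "color_of G v")
        case ColZ
        have nbrs: "parcs (ugraph ?H) `` {p} = ?N \<union> Pair v ` (?E' `` {?r})"
          using v vu True ColZ by (auto simp: z_comb_def)
        \<comment> \<open>A common element could only be \<open>(v, ?r)\<close>, which would require
          a loop of \<open>G\<close> at \<open>v\<close>.\<close>
        have "?N \<inter> Pair v ` (?E' `` {?r}) = {}" using arcs_loopfree[OF G] by auto
        \<comment> \<open>The copy contributes \<open>x v / f + z * x v\<close>. Its second term
          cancels the diagonal term for the color value \<open>z\<close>; the first is exactly the
          diagonal term for the color value \<open>- (1 / f)\<close>. So the attached copy acts as a
          change of \<open>z\<close> to \<open>- (1 / f)\<close>.\<close>
        then have "(\<Sum>q\<in>parcs (ugraph ?H) `` {p}. X q) =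
            (\<Sum>v'\<in>?E `` {v}. x v') + x v / f * (1 + z * f)"
          unfolding nbrs using finE copy[OF r, of v] N assms(3)
          by (subst sum.union_disjoint) (auto simp: yr)
        then show ?thesis
          using ColZ vu True f0 Xr[of v] by (simp add: adj_op_def z_comb_def field_simps)
      next
        case ColW
        then have nbrs: "parcs (ugraph ?H) `` {p} = ?N"
          using v vu True by (auto simp: z_comb_def)
        show ?thesis
          unfolding adj_op_def nbrs N using ColW vu True Xr[of v] by (simp add: z_comb_def)
      qed
      then show ?thesis using x[OF v] vu True by (simp add: z_comb_def)
    qed
  qed
  then have "rep_fun ?H z w = X (base ?H)"
    unfolding rep_fun_def
    using is_colored_graph_z_comb[OF G G'] im base_in_verts by (intro rep_fun_at_eqI) blast+
  then show ?thesis
    using xb Xr[of "base G"] by (simp add: recip_rep_fun_def f_def z_comb_def)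
qed

end
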